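(* There exist an absolute constant $c>0$ and, for all positive integers $d,s$, a constant $C_{d,s}>0$ such that the following holds for every positive integer $t$ and every integer $n\ge 3$. Let $G$ be an $n$-vertex graph whose vertices are points in $\mathbb{R}^d$, such that a pair of vertices forms an edge if and only if it satisfies a fixed Boolean combination of $s$ linear inequalities in $2d$ variables. If $G$ contains no $K_{t,t}$ as a subgraph, then $G$ has at most $C_{d,s}\,t\,n(\log n)^{cd}$ edges.
   Context: The hypothesis on $G$ means: $V(G)\subset\mathbb{R}^d$ with $|V(G)|=n$, and there are $s$ linear inequalities in $2d$ variables (each given by a, not necessarily homogeneous, linear function $f_i:\mathbb{R}^{d}\times\mathbb{R}^d\to\mathbb{R}$) and a Boolean formula $\Phi$ in these $s$ inequalities such that for distinct $x,y\in V(G)$, $\{x,y\}$ is an edge of $G$ if and only if $(x,y)$ satisfies $\Phi$ (so $\Phi$ is symmetric on distinct pairs of vertices of $G$). $K_{t,t}$ is the complete bipartite graph with both classes of size $t$. *)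

theory Defs
  imports "HOL-Analysis.Abstract_Euclidean_Space" "HOL-Library.Ramsey"
begin

text \<open>
  The dimension is quantified inside the theorem, so a point of \<open>d\<close>-dimensional space is an element
  of \<^term>\<open>topspace (Euclidean_space d)\<close>: a function \<^typ>\<open>nat \<Rightarrow> real\<close> vanishing at all indices
  \<open>i \<ge> d\<close>, the coordinates being those with \<open>i < d\<close>.
\<close>

definition affine_function :: "nat \<Rightarrow> ((nat \<Rightarrow> real) \<Rightarrow> (nat \<Rightarrow> real) \<Rightarrow> real) \<Rightarrow> bool" where
  "affine_function d f \<longleftrightarrow>
     (\<exists>a b c. \<forall>x \<in> topspace (Euclidean_space d). \<forall>y \<in> topspace (Euclidean_space d).
        f x y = (\<Sum>j<d. a j * x j) + (\<Sum>j<d. b j * y j) + c)"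

datatype (atoms: 'a) bool_formula =
  Atom 'a
| Neg "'a bool_formula"
| Conj "'a bool_formula" "'a bool_formula"
| Disj "'a bool_formula" "'a bool_formula"

primrec satisfies :: "('a \<Rightarrow> bool) \<Rightarrow> 'a bool_formula \<Rightarrow> bool" where
  "satisfies v (Atom i) \<longleftrightarrow> v i"
| "satisfies v (Neg \<phi>) \<longleftrightarrow> \<not> satisfies v \<phi>"
| "satisfies v (Conj \<phi> \<psi>) \<longleftrightarrow> satisfies v \<phi> \<and> satisfies v \<psi>"
| "satisfies v (Disj \<phi> \<psi>) \<longleftrightarrow> satisfies v \<phi> \<or> satisfies v \<psi>"

definition simple_graph :: "'a set \<Rightarrow> 'a set set \<Rightarrow> bool" where
  "simple_graph V E \<longleftrightarrow> finite V \<and> E \<subseteq> [V]\<^bsup>2\<^esup>"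

text \<open>
  Atom \<open>i\<close> stands for the inequality \<open>f i x y \<le> 0\<close>.  The other forms \<open>\<ge>\<close>, \<open><\<close>, \<open>>\<close> of a linear
  inequality are obtained by replacing \<open>f i\<close> by its negative and/or negating the atom.
\<close>

definition semilinear_graph ::
    "nat \<Rightarrow> nat \<Rightarrow> (nat \<Rightarrow> real) set \<Rightarrow> (nat \<Rightarrow> real) set set \<Rightarrow> bool" where
  "semilinear_graph d s V E \<longleftrightarrow>
     simple_graph V E \<and> V \<subseteq> topspace (Euclidean_space d) \<and>
     (\<exists>f :: nat \<Rightarrow> (nat \<Rightarrow> real) \<Rightarrow> (nat \<Rightarrow> real) \<Rightarrow> real. \<exists>\<Phi> :: nat bool_formula.
        (\<forall>i<s. affine_function d (f i)) \<and> atoms \<Phi> \<subseteq> {..<s} \<and>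
        (\<forall>x\<in>V. \<forall>y\<in>V. x \<noteq> y \<longrightarrow>
           ({x, y} \<in> E \<longleftrightarrow> satisfies (\<lambda>i. f i x y \<le> 0) \<Phi>)))"

definition contains_Ktt :: "nat \<Rightarrow> 'a set \<Rightarrow> 'a set set \<Rightarrow> bool" where
  "contains_Ktt t V E \<longleftrightarrow>
     (\<exists>A B. A \<subseteq> V \<and> B \<subseteq> V \<and> A \<inter> B = {} \<and> card A = t \<and> card B = t \<and>
        (\<forall>a\<in>A. \<forall>b\<in>B. {a, b} \<in> E))"

end

theory Submission
  imports Defs
begin

text \<open>
  If \<open>k\<close> relations are each of threshold type \<open>u x \<le> v y\<close>, divide and conquer on one of them
  (halve the points according to the threshold order; one of the two cross pairs satisfies the
  relation identically, the other nowhere) bounds a \<open>K\<^sub>T\<^sub>,\<^sub>T\<close>-free conjunction by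
  \<open>T N (log N)\<^sup>k\<close>.  To get an exponent independent of the number \<open>s\<close> of inequalities, fix \<open>y\<close>
  and decompose the polytope of the \<open>x\<close> satisfying them vertically: among the inequalities whose
  coefficient of the last coordinate has a given sign only the tightest one matters, and being
  the tightest is a system of inequalities that no longer involves the last coordinate.  Hence
  eliminating one coordinate costs three threshold relations and a factor \<open>(s + 1)\<^sup>3\<close>.
\<close>

section \<open>Ferrers relations and divide and conquer\<close>

definition biclique_free :: "nat \<Rightarrow> ('a \<times> 'b) set \<Rightarrow> bool" where
  "biclique_free T Q \<longleftrightarrow>
     (\<forall>A B. finite A \<longrightarrow> finite B \<longrightarrow> A \<times> B \<subseteq> Q \<longrightarrow> card A < T \<or> card B < T)"

lemma biclique_free_subset: "biclique_free T Q \<Longrightarrow> R \<subseteq> Q \<Longrightarrow> biclique_free T R"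
  unfolding biclique_free_def by (meson subset_trans)

text \<open>Equivalently, the neighbourhoods \<open>{y. P x y}\<close> form a chain under inclusion.
  This order-free form of a threshold relation spares carrying the functions \<open>u\<close> and
  \<open>v\<close> through the splitting.\<close>

definition ferrers :: "('a \<Rightarrow> 'b \<Rightarrow> bool) \<Rightarrow> bool" where
  "ferrers P \<longleftrightarrow> (\<forall>x x' y y'. P x y \<longrightarrow> P x' y' \<longrightarrow> P x y' \<or> P x' y)"

lemma ferrers_threshold: "ferrers (\<lambda>x y. u x \<le> (v y :: 'c::linorder))"
  unfolding ferrers_def by (meson le_cases order_trans)

lemma ferrers_True: "ferrers (\<lambda>x y. True)"
  unfolding ferrers_def by simp

text \<open>A vertex of \<open>A\<close> of maximal degree is adjacent to all of \<open>B\<close>, unless \<open>B\<close> has an isolated vertex.\<close>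

lemma ferrers_extreme:
  assumes "ferrers P" and fin: "finite A" "finite B" and "A \<noteq> {} \<or> B \<noteq> {}"
  shows "(\<exists>x\<in>A. \<forall>y\<in>B. P x y) \<or> (\<exists>y\<in>B. \<forall>x\<in>A. \<not> P x y)"
proof (cases "A = {}")
  case True
  then show ?thesis using assms by auto
next
  case False
  define deg where "deg = (\<lambda>x. card {y\<in>B. P x y})"
  obtain x where x: "x \<in> A" "\<And>x'. x' \<in> A \<Longrightarrow> deg x' \<le> deg x"
  proof -
    have "Max (deg ` A) \<in> deg ` A" using fin False by simp
    then obtain x where "x \<in> A" "deg x = Max (deg ` A)" by auto
    moreover have "deg x' \<le> Max (deg ` A)" if "x' \<in> A" for x' using that fin by simp
    ultimately show ?thesis using that by metis
  qed
  show ?thesis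
  proof (rule ccontr)
    assume neg: "\<not> ?thesis"
    then obtain y where y: "y \<in> B" "\<not> P x y" using x by blast
    then obtain x' where x': "x' \<in> A" "P x' y" using neg by blast
    \<comment> \<open>The two neighbourhoods are nested, and \<open>y\<close> lies in the second
      only.\<close>
    have "{y\<in>B. P x y} \<subset> {y\<in>B. P x' y}"
      using assms(1) x' y unfolding ferrers_def by blast
    then have "deg x < deg x'" unfolding deg_def by (intro psubset_card_mono) (use fin in auto)
    then show False using x(2)[OF x'(1)] by simp
  qed
qed

text \<open>Peel off extreme elements one at a time: an \<open>x\<close> adjacent to all that is
  left of \<open>B\<close> goes to \<open>A1\<close>, a \<open>y\<close> adjacent to nothing that is
  left of \<open>A\<close> goes to \<open>B1\<close>. Both conditions survive, since the remainders
  only shrink. This cuts the threshold order after \<open>q\<close> elements.\<close>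

lemma ferrers_split:
  assumes "ferrers P" "finite A" "finite B" "q \<le> card A + card B"
  shows "\<exists>A1 B1. A1 \<subseteq> A \<and> B1 \<subseteq> B \<and> card A1 + card B1 = q \<and>
           (\<forall>x\<in>A1. \<forall>y\<in>B - B1. P x y) \<and> (\<forall>x\<in>A - A1. \<forall>y\<in>B1. \<not> P x y)"
  using assms(4)
proof (induction q)
  case 0
  show ?case by (rule exI[of _ "{}"], rule exI[of _ "{}"]) simp
next
  case (Suc q)
  then obtain A1 B1 where *: "A1 \<subseteq> A" "B1 \<subseteq> B" "card A1 + card B1 = q"
      "\<forall>x\<in>A1. \<forall>y\<in>B - B1. P x y" "\<forall>x\<in>A - A1. \<forall>y\<in>B1. \<not> P x y"
    by auto
  have fin: "finite A1" "finite B1" using * assms finite_subset by auto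
  have "A - A1 \<noteq> {} \<or> B - B1 \<noteq> {}"
  proof (rule ccontr)
    assume "\<not> ?thesis"
    then have "A1 = A" "B1 = B" using * by auto
    then show False using * Suc.prems by simp
  qed
  then consider x where "x \<in> A - A1" "\<forall>y\<in>B - B1. P x y"
    | y where "y \<in> B - B1" "\<forall>x\<in>A - A1. \<not> P x y"
    using ferrers_extreme[OF assms(1), of "A - A1" "B - B1"] assms by auto
  then show ?case
  proof cases
    case 1
    show ?thesis
      by (rule exI[of _ "insert x A1"], rule exI[of _ B1]) (use 1 * fin in auto)
  next
    case 2
    show ?thesis
      by (rule exI[of _ A1], rule exI[of _ "insert y B1"]) (use 2 * fin in auto)
  qed
qed

text \<open>Induction on the list and, inside it, on \<open>m\<close>. A cut in the middle along the
  first relation leaves two problems of half the size and one cross pair on which that relation is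
  automatic, whence the recurrence g(k, m + 1) <= 2 g(k, m) + g(k - 1, m + 1).\<close>

lemma ferrers_conj_card_bound:
  assumes "finite A" "finite B" "card A + card B \<le> 2 ^ m" "\<forall>P\<in>set Ps. ferrers P"
    and "biclique_free T {(x, y) \<in> A \<times> B. \<forall>P\<in>set Ps. P x y}"
  shows "card {(x, y) \<in> A \<times> B. \<forall>P\<in>set Ps. P x y} \<le> T * 2 ^ m * (m + 1) ^ length Ps"
  using assms
proof (induction Ps arbitrary: A B m)
  case Nil
  have "{(x, y) \<in> A \<times> B. \<forall>P\<in>set []. P x y} = A \<times> B" by auto
  moreover have "card A < T \<or> card B < T"
    using Nil unfolding biclique_free_def by auto
  then have "card A * card B \<le> T * (card A + card B)"
  proof
    assume "card A < T"
    then have "card A * card B \<le> T * card B" by (intro mult_le_mono1) simp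
    then show ?thesis unfolding add_mult_distrib2 by linarith
  next
    assume "card B < T"
    then have "card A * card B \<le> card A * T" by (intro mult_le_mono2) simp
    then show ?thesis unfolding add_mult_distrib2 mult.commute[of T] by linarith
  qed
  then have "card A * card B \<le> T * 2 ^ m"
    using Nil.prems(3) by (meson le_trans mult_le_mono2)
  ultimately show ?case by (simp add: card_cartesian_product)
next
  case (Cons P Ps)
  note IH = Cons.IH and P = Cons.prems(4)
  define Q where "Q = (\<lambda>A B. {(x, y) \<in> A \<times> B. \<forall>P\<in>set (P # Ps). P x y})"
  have "card (Q A B) \<le> T * 2 ^ m * (m + 1) ^ Suc (length Ps)"
    if "finite A" "finite B" "card A + card B \<le> 2 ^ m" "biclique_free T (Q A B)" for A B
    using that
  proof (induction m arbitrary: A B)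
    case 0
    then have "card A = 0 \<or> card B = 0" unfolding power_0 by linarith
    then have "A = {} \<or> B = {}" using 0 by simp
    then have "Q A B = {}" unfolding Q_def by auto
    then show ?case by simp
  next
    case (Suc m)
    obtain A1 B1 where s: "A1 \<subseteq> A" "B1 \<subseteq> B" "card A1 + card B1 = (card A + card B) div 2"
        "\<forall>x\<in>A1. \<forall>y\<in>B - B1. P x y" "\<forall>x\<in>A - A1. \<forall>y\<in>B1. \<not> P x y"
      using ferrers_split[of P A B "(card A + card B) div 2"] P Suc.prems by auto
    define A2 B2 where "A2 = A - A1" and "B2 = B - B1"
    have fin: "finite A1" "finite B1" "finite A2" "finite B2"
      using s Suc.prems finite_subset unfolding A2_def B2_def by auto
    have "card A2 = card A - card A1" "card B2 = card B - card B1"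
      unfolding A2_def B2_def using s fin by (auto intro: card_Diff_subset)
    moreover have "card A1 \<le> card A" "card B1 \<le> card B"
      using s Suc.prems by (auto intro: card_mono)
    \<comment> \<open>Both halves fit into \<open>2 ^ m\<close> however the division rounds. The
      cross pair \<open>A1\<close>, \<open>B2\<close> may contain everything, so it stays at level
      \<open>Suc m\<close>.\<close>
    ultimately have le: "card A1 + card B1 \<le> 2 ^ m" "card A2 + card B2 \<le> 2 ^ m"
        "card A1 + card B2 \<le> 2 ^ Suc m"
      using s Suc.prems(3) by auto
    define R where "R = {(x, y) \<in> A1 \<times> B2. \<forall>P\<in>set Ps. P x y}"
    have sub: "Q A1 B1 \<subseteq> Q A B" "Q A2 B2 \<subseteq> Q A B" "R \<subseteq> Q A B"
      using s unfolding Q_def R_def A2_def B2_def by auto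
    \<comment> \<open>\<open>A2 \<times> B1\<close> contributes nothing because \<open>P\<close>
      fails there; on \<open>A1 \<times> B2\<close> it always holds, so \<open>R\<close> omits
      it.\<close>
    have Q: "Q A B = Q A1 B1 \<union> Q A2 B2 \<union> R"
      using s unfolding Q_def R_def A2_def B2_def by auto
    have "card (Q A1 B1) \<le> T * 2 ^ m * (m + 1) ^ Suc (length Ps)"
      using Suc.IH[of A1 B1] fin le biclique_free_subset[OF Suc.prems(4)] sub by auto
    moreover have "card (Q A2 B2) \<le> T * 2 ^ m * (m + 1) ^ Suc (length Ps)"
      using Suc.IH[of A2 B2] fin le biclique_free_subset[OF Suc.prems(4)] sub by auto
    moreover have "card R \<le> T * 2 ^ Suc m * (Suc m + 1) ^ length Ps"
      using IH[of A1 B2 "Suc m"] fin le biclique_free_subset[OF Suc.prems(4)] sub P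
      unfolding R_def by auto
    moreover have "card (Q A B) \<le> card (Q A1 B1) + card (Q A2 B2) + card R"
      unfolding Q by (meson add_mono_thms_linordered_semiring(3) card_Un_le le_trans)
    ultimately have "card (Q A B) \<le> 2 * (T * 2 ^ m * (m + 1) ^ Suc (length Ps))
        + T * 2 ^ Suc m * (Suc m + 1) ^ length Ps"
      by linarith
    also have "\<dots> = T * 2 ^ Suc m * ((m + 1) * (m + 1) ^ length Ps + (m + 2) ^ length Ps)"
      by (simp add: algebra_simps)
    \<comment> \<open>Raising the base to \<open>m + 2\<close> gives both terms the same power, and
      (m + 1) + 1 = m + 2 closes the induction.\<close>
    also have "\<dots> \<le> T * 2 ^ Suc m * ((m + 1) * (m + 2) ^ length Ps + (m + 2) ^ length Ps)"
      by (intro mult_le_mono2 add_le_mono1 power_mono) auto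
    also have "\<dots> = T * 2 ^ Suc m * (Suc m + 1) ^ Suc (length Ps)"
      by (simp add: algebra_simps)
    finally show ?case .
  qed
  from this[of A B] Cons.prems show ?case unfolding Q_def by simp
qed

section \<open>Half-spaces and elimination of coordinates\<close>

type_synonym 'b halfspace = "(nat \<Rightarrow> real) \<times> ('b \<Rightarrow> real)"

text \<open>The coefficients do not depend on \<open>y\<close> and the right-hand side is an
  arbitrary function of \<open>y\<close>. So differences and positive multiples stay of this kind,
  and each inequality is a threshold relation.\<close>

definition holds :: "nat \<Rightarrow> 'b halfspace \<Rightarrow> (nat \<Rightarrow> real) \<Rightarrow> 'b \<Rightarrow> bool" where
  "holds d h x y \<longleftrightarrow> (\<Sum>j<d. fst h j * x j) \<le> snd h y"

lemma ferrers_holds: "ferrers (holds d h)"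
  unfolding holds_def by (rule ferrers_threshold)

lemma holds_scale:
  assumes "r > 0"
  shows "holds d (\<lambda>j. r * a j, \<lambda>y. r * w y) x y \<longleftrightarrow> holds d (a, w) x y"
proof -
  have "(\<Sum>j<d. r * a j * x j) = r * (\<Sum>j<d. a j * x j)"
    by (simp add: sum_distrib_left mult.assoc)
  then show ?thesis using assms by (simp add: holds_def)
qed

text \<open>In each option only \<open>P\<close> may still involve the coordinate with index
  \<open>d\<close>. The \<open>+ 1\<close> provides for the empty list, which needs one trivial
  option.\<close>

definition eliminates_last ::
    "nat \<Rightarrow> 'b halfspace list \<Rightarrow> (((nat \<Rightarrow> real) \<Rightarrow> 'b \<Rightarrow> bool) \<times> 'b halfspace list) set \<Rightarrow> bool"
  where "eliminates_last d hs opts \<longleftrightarrow>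
    finite opts \<and> card opts \<le> length hs + 1 \<and>
    (\<forall>(P, hs')\<in>opts. ferrers P \<and> length hs' = length hs) \<and>
    (\<forall>x y. (\<forall>h\<in>set hs. holds (Suc d) h x y) \<longleftrightarrow>
       (\<exists>(P, hs')\<in>opts. P x y \<and> (\<forall>h\<in>set hs'. holds d h x y)))"

text \<open>With a common last coefficient all half-spaces bound the same quantity
  \<open>\<sigma> * x d\<close>, so they hold together iff the tightest one does. Being tightest is
  a system of comparisons in which this quantity cancels; each candidate gives one option.\<close>

lemma tightest_halfspace:
  fixes hs :: "'b halfspace list"
  assumes same: "\<forall>h\<in>set hs. fst h d = \<sigma>"
  shows "\<exists>opts. eliminates_last d hs opts"
proof (cases "hs = []")
  case True
  then show ?thesis
    by (intro exI[of _ "{(\<lambda>x y. True, [])}"]) (simp add: ferrers_True eliminates_last_def)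
next
  case False
  define diff :: "'b halfspace \<Rightarrow> 'b halfspace \<Rightarrow> 'b halfspace" where
    "diff = (\<lambda>g h. (\<lambda>j. fst h j - fst g j, \<lambda>y. snd h y - snd g y))"
  \<comment> \<open>The trivial comparison of \<open>g\<close> with itself is kept, so that the
    number of half-spaces does not change.\<close>
  define opts where "opts = (\<lambda>g. (holds (Suc d) g, map (diff g) hs)) ` set hs"
  define slack :: "'b halfspace \<Rightarrow> (nat \<Rightarrow> real) \<Rightarrow> 'b \<Rightarrow> real" where
    "slack = (\<lambda>h x y. snd h y - (\<Sum>j<d. fst h j * x j))"
  have holds_slack: "holds (Suc d) h x y \<longleftrightarrow> \<sigma> * x d \<le> slack h x y" if "h \<in> set hs" for h x y
    using that same unfolding holds_def slack_def by auto
  have holds_diff: "holds d (diff g h) x y \<longleftrightarrow> slack g x y \<le> slack h x y" for g h x y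
    unfolding holds_def slack_def diff_def by (auto simp: sum_subtractf algebra_simps)
  have "(\<forall>h\<in>set hs. holds (Suc d) h x y) \<longleftrightarrow>
      (\<exists>(P, hs')\<in>opts. P x y \<and> (\<forall>h\<in>set hs'. holds d h x y))" for x y
  proof -
    have "(\<exists>(P, hs')\<in>opts. P x y \<and> (\<forall>h\<in>set hs'. holds d h x y)) \<longleftrightarrow>
        (\<exists>g\<in>set hs. \<sigma> * x d \<le> slack g x y \<and> (\<forall>h\<in>set hs. slack g x y \<le> slack h x y))"
      unfolding opts_def using holds_slack by (auto simp: holds_diff)
    also have "\<dots> \<longleftrightarrow> (\<forall>h\<in>set hs. \<sigma> * x d \<le> slack h x y)"
    proof
      assume *: "\<forall>h\<in>set hs. \<sigma> * x d \<le> slack h x y"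
      have "Min ((\<lambda>h. slack h x y) ` set hs) \<in> (\<lambda>h. slack h x y) ` set hs"
        using False by simp
      then obtain g where "g \<in> set hs" "slack g x y = Min ((\<lambda>h. slack h x y) ` set hs)" by auto
      then show "\<exists>g\<in>set hs. \<sigma> * x d \<le> slack g x y \<and> (\<forall>h\<in>set hs. slack g x y \<le> slack h x y)"
        using * by (intro bexI[of _ g]) auto
    qed (use order_trans in blast)
    finally show ?thesis using holds_slack by simp
  qed
  moreover have "card opts \<le> length hs + 1"
    unfolding opts_def by (meson card_image_le card_length finite_set le_trans trans_le_add1)
  moreover have "\<forall>(P, hs')\<in>opts. ferrers P \<and> length hs' = length hs"
    unfolding opts_def by (auto simp: ferrers_holds)
  ultimately show ?thesis
    by (intro exI[of _ opts]) (simp add: opts_def eliminates_last_def)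
qed

text \<open>Dividing by the absolute value of the coefficient leaves three classes, each with the
  common coefficient that \<open>tightest_halfspace\<close> asks for.\<close>

lemma normalized_halfspaces:
  fixes hs :: "'b halfspace list"
  obtains hs' where "length hs' = length hs" "\<forall>h\<in>set hs'. fst h d \<in> {-1, 0, 1}"
    "\<And>x y. (\<forall>h\<in>set hs'. holds k h x y) \<longleftrightarrow> (\<forall>h\<in>set hs. holds k h x y)"
proof -
  \<comment> \<open>The value 1 for a vanishing coefficient keeps the factor positive.\<close>
  define r where "r = (\<lambda>h :: 'b halfspace. if fst h d = 0 then 1 else 1 / \<bar>fst h d\<bar>)"
  define norm where "norm = (\<lambda>h :: 'b halfspace. (\<lambda>j. r h * fst h j, \<lambda>y. r h * snd h y))"
  have "holds k (norm h) x y \<longleftrightarrow> holds k h x y" for h x y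
    using holds_scale[of "r h" k "fst h" "snd h"] unfolding norm_def by (simp add: r_def)
  moreover have "fst (norm h) d \<in> {-1, 0, 1}" for h
    unfolding norm_def r_def by (auto simp: abs_if)
  ultimately show ?thesis
    by (intro that[of "map norm hs"]) auto
qed

text \<open>Induction on \<open>d\<close>: one option for each of the three sign classes determines
  a piece. A piece has one coordinate less, three more Ferrers relations and equally many
  half-spaces, so the induction must admit arbitrary \<open>Ps\<close>.\<close>

lemma halfspaces_card_bound:
  fixes A :: "(nat \<Rightarrow> real) set" and B :: "'b set"
  assumes "finite A" "finite B" "card A + card B \<le> 2 ^ m" "\<forall>P\<in>set Ps. ferrers P"
    and "biclique_free T
           {(x, y) \<in> A \<times> B. (\<forall>P\<in>set Ps. P x y) \<and> (\<forall>h\<in>set hs. holds d h x y)}"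
  shows "card {(x, y) \<in> A \<times> B. (\<forall>P\<in>set Ps. P x y) \<and> (\<forall>h\<in>set hs. holds d h x y)}
    \<le> (length hs + 1) ^ (3 * d) * (T * 2 ^ m * (m + 1) ^ (length Ps + 3 * d))"
  using assms(4,5)
proof (induction d arbitrary: Ps hs)
  case 0
  \<comment> \<open>With no coordinates left, a half-space is a condition on \<open>y\<close> alone
    and just shrinks \<open>B\<close>.\<close>
  define B' where "B' = {y\<in>B. \<forall>h\<in>set hs. 0 \<le> snd h y}"
  have eq: "{(x, y) \<in> A \<times> B. (\<forall>P\<in>set Ps. P x y) \<and> (\<forall>h\<in>set hs. holds 0 h x y)} =
      {(x, y) \<in> A \<times> B'. \<forall>P\<in>set Ps. P x y}"
    unfolding B'_def holds_def by auto
  have "card B' \<le> card B" unfolding B'_def using assms(2) by (auto intro: card_mono)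
  then show ?case
    using ferrers_conj_card_bound[of A B' m Ps T] 0 assms(1-3) unfolding eq B'_def by auto
next
  case (Suc d)
  define Q where
    "Q = {(x, y) \<in> A \<times> B. (\<forall>P\<in>set Ps. P x y) \<and> (\<forall>h\<in>set hs. holds (Suc d) h x y)}"
  obtain ns where ns: "length ns = length hs" "\<forall>h\<in>set ns. fst h d \<in> {-1, 0, 1}"
    "\<And>x y. (\<forall>h\<in>set ns. holds (Suc d) h x y) \<longleftrightarrow> (\<forall>h\<in>set hs. holds (Suc d) h x y)"
    using normalized_halfspaces[of hs d "Suc d"] by blast
  define cls where "cls = (\<lambda>\<sigma>. filter (\<lambda>h. fst h d = \<sigma>) ns)"
  have "\<exists>opts. eliminates_last d (cls \<sigma>) opts" for \<sigma>
    by (rule tightest_halfspace[where \<sigma> = \<sigma>]) (simp add: cls_def)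
  then obtain opts where elim: "\<And>\<sigma>. eliminates_last d (cls \<sigma>) (opts \<sigma>)"
    by metis
  have opts: "finite (opts \<sigma>)" "card (opts \<sigma>) \<le> length (cls \<sigma>) + 1"
      "(P, hs') \<in> opts \<sigma> \<Longrightarrow> ferrers P \<and> length hs' = length (cls \<sigma>)"
      "(\<forall>h\<in>set (cls \<sigma>). holds (Suc d) h x y) \<longleftrightarrow>
         (\<exists>(P, hs')\<in>opts \<sigma>. P x y \<and> (\<forall>h\<in>set hs'. holds d h x y))" for \<sigma> P hs' x y
    using elim[of \<sigma>] unfolding eliminates_last_def by blast+
  have length_cls: "length (cls (-1)) + length (cls 0) + length (cls 1) = length hs"
  proof -
    have "length (filter (\<lambda>h. fst h d = -1) ks) + length (filter (\<lambda>h. fst h d = 0) ks)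
        + length (filter (\<lambda>h. fst h d = 1) ks) = length ks"
      if "\<forall>h\<in>set ks. fst h d \<in> {-1, 0, 1}" for ks :: "'b halfspace list"
      using that by (induction ks) auto
    then show ?thesis using ns unfolding cls_def by auto
  qed
  define I where "I = opts (-1) \<times> opts 0 \<times> opts 1"
  define piece where "piece = (\<lambda>((P1, h1), (P2, h2), (P3, h3)).
    {(x, y) \<in> A \<times> B. (\<forall>P\<in>set (P1 # P2 # P3 # Ps). P x y) \<and>
       (\<forall>h\<in>set (h1 @ h2 @ h3). holds d h x y)})"
  have Q: "Q = (\<Union>i\<in>I. piece i)"
  proof -
    define ok :: "((nat \<Rightarrow> real) \<Rightarrow> 'b \<Rightarrow> bool) \<times> 'b halfspace list \<Rightarrow> (nat \<Rightarrow> real) \<Rightarrow> 'b \<Rightarrow> bool"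
      where "ok = (\<lambda>(P, hs') x y. P x y \<and> (\<forall>h\<in>set hs'. holds d h x y))"
    have "set ns = set (cls (-1)) \<union> set (cls 0) \<union> set (cls 1)"
      using ns(2) unfolding cls_def set_filter by fast
    then have "(\<forall>h\<in>set hs. holds (Suc d) h x y) \<longleftrightarrow>
        (\<exists>p\<in>opts (-1). ok p x y) \<and> (\<exists>p\<in>opts 0. ok p x y) \<and> (\<exists>p\<in>opts 1. ok p x y)" for x y
      unfolding ns(3)[of x y, symmetric] ok_def
      by (simp only: ball_Un opts(4) conj_assoc case_prod_beta')
    moreover have "(x, y) \<in> piece (p1, p2, p3) \<longleftrightarrow> x \<in> A \<and> y \<in> B \<and> (\<forall>P\<in>set Ps. P x y) \<and>
        ok p1 x y \<and> ok p2 x y \<and> ok p3 x y" for p1 p2 p3 x y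
      unfolding piece_def ok_def by (cases p1; cases p2; cases p3) auto
    ultimately have "(x, y) \<in> Q \<longleftrightarrow> (\<exists>i\<in>I. (x, y) \<in> piece i)" for x y
      unfolding Q_def I_def by auto
    then show ?thesis by auto
  qed
  have "card (piece i)
      \<le> (length hs + 1) ^ (3 * d) * (T * 2 ^ m * (m + 1) ^ (length Ps + 3 * Suc d))"
    if "i \<in> I" for i
  proof -
    obtain P1 h1 P2 h2 P3 h3 where i: "i = ((P1, h1), (P2, h2), (P3, h3))"
      "(P1, h1) \<in> opts (-1)" "(P2, h2) \<in> opts 0" "(P3, h3) \<in> opts 1"
      using \<open>i \<in> I\<close> unfolding I_def by auto
    \<comment> \<open>The classes partition the normalized list and options preserve lengths, so the
      base \<open>length hs + 1\<close> is the same at every level.\<close>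
    have len: "length (h1 @ h2 @ h3) = length hs"
      using opts(3)[OF i(2)] opts(3)[OF i(3)] opts(3)[OF i(4)] length_cls by simp
    have "piece i \<subseteq> Q" using that Q by blast
    then have "biclique_free T (piece i)"
      using biclique_free_subset Suc.prems(2) unfolding Q_def by blast
    moreover have "\<forall>P\<in>set (P1 # P2 # P3 # Ps). ferrers P"
      using opts(3)[OF i(2)] opts(3)[OF i(3)] opts(3)[OF i(4)] Suc.prems(1) by simp
    ultimately have "card (piece i) \<le> (length (h1 @ h2 @ h3) + 1) ^ (3 * d) *
        (T * 2 ^ m * (m + 1) ^ (length (P1 # P2 # P3 # Ps) + 3 * d))"
      using Suc.IH[of "P1 # P2 # P3 # Ps" "h1 @ h2 @ h3"] unfolding i(1) piece_def prod.case
      by blast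
    then show ?thesis unfolding len by (simp add: algebra_simps numeral_3_eq_3)
  qed
  then have "(\<Sum>i\<in>I. card (piece i))
      \<le> card I * ((length hs + 1) ^ (3 * d) * (T * 2 ^ m * (m + 1) ^ (length Ps + 3 * Suc d)))"
    using sum_bounded_above[of I "\<lambda>i. card (piece i)"] by simp
  moreover have "card Q \<le> (\<Sum>i\<in>I. card (piece i))"
    unfolding Q by (rule card_UN_le) (simp add: I_def opts(1))
  moreover have "card I \<le> (length hs + 1) ^ 3"
  proof -
    have "card (opts \<sigma>) \<le> length hs + 1" for \<sigma> :: real
      using opts(2)[of \<sigma>] ns(1) length_filter_le[of "\<lambda>h. fst h d = \<sigma>" ns]
      unfolding cls_def by linarith
    then show ?thesis
      unfolding I_def card_cartesian_product power3_eq_cube mult.assoc by (intro mult_le_mono)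
  qed
  ultimately have "card Q \<le> (length hs + 1) ^ 3 *
      ((length hs + 1) ^ (3 * d) * (T * 2 ^ m * (m + 1) ^ (length Ps + 3 * Suc d)))"
    by (meson le_trans mult_le_mono1)
  then show ?case
    unfolding Q_def by (simp only: mult_Suc_right power_add mult.assoc)
qed

section \<open>From Boolean formulas to half-spaces\<close>

lemma satisfies_cong: "(\<And>i. i \<in> atoms \<phi> \<Longrightarrow> v i = w i) \<Longrightarrow> satisfies v \<phi> = satisfies w \<phi>"
  by (induction \<phi>) auto

text \<open>Turns the strict inequality of a negated atom into a weak one, since \<open>V\<close> is finite.\<close>

lemma finite_positive_gap:
  fixes S :: "real set"
  assumes "finite S"
  obtains e where "e > 0" "\<And>z. z \<in> S \<Longrightarrow> z > 0 \<longleftrightarrow> e \<le> z"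
proof
  let ?e = "Min (insert 1 {z\<in>S. z > 0})"
  show "?e > 0" using assms by (subst Min_gr_iff) auto
  moreover have "?e \<le> z" if "z \<in> S" "z > 0" for z
    using assms that by (intro Min_le) auto
  ultimately show "z > 0 \<longleftrightarrow> ?e \<le> z" if "z \<in> S" for z
    using that by (meson less_le_trans)
qed

text \<open>For \<open>i \<in> S\<close> the terms in \<open>y\<close> and the constant move to the
  right. For \<open>i \<notin> S\<close> the condition \<open>f i x y > 0\<close> becomes
  \<open>f i x y \<ge> e\<close>, equivalent on the finite set \<open>V \<times> V\<close>, and is
  multiplied by -1.\<close>

lemma affine_pattern_halfspaces:
  fixes f :: "nat \<Rightarrow> (nat \<Rightarrow> real) \<Rightarrow> (nat \<Rightarrow> real) \<Rightarrow> real"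
  assumes "\<forall>i<s. affine_function d (f i)" "finite V" "V \<subseteq> topspace (Euclidean_space d)"
  obtains hs :: "(nat \<Rightarrow> real) halfspace list" where "length hs = s"
    "\<And>x y. x \<in> V \<Longrightarrow> y \<in> V \<Longrightarrow>
       (\<forall>h\<in>set hs. holds d h x y) \<longleftrightarrow> (\<forall>i<s. f i x y \<le> 0 \<longleftrightarrow> i \<in> S)"
proof -
  have "\<exists>h :: (nat \<Rightarrow> real) halfspace.
      \<forall>x\<in>V. \<forall>y\<in>V. holds d h x y \<longleftrightarrow> (f i x y \<le> 0 \<longleftrightarrow> i \<in> S)" if "i < s" for i
  proof -
    obtain a b c where f: "\<And>x y. x \<in> V \<Longrightarrow> y \<in> V \<Longrightarrow>
        f i x y = (\<Sum>j<d. a j * x j) + (\<Sum>j<d. b j * y j) + c"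
    proof -
      have "affine_function d (f i)" using assms(1) \<open>i < s\<close> by blast
      then show ?thesis
        unfolding affine_function_def using assms(3) that by (elim exE) blast
    qed
    obtain e where e: "e > 0" "\<And>z. z \<in> (\<lambda>(x, y). f i x y) ` (V \<times> V) \<Longrightarrow> z > 0 \<longleftrightarrow> e \<le> z"
      using finite_positive_gap[of "(\<lambda>(x, y). f i x y) ` (V \<times> V)"] assms(2) by blast
    have gap: "f i x y > 0 \<longleftrightarrow> e \<le> f i x y" if "x \<in> V" "y \<in> V" for x y
      using e(2)[of "f i x y"] that by auto
    show ?thesis
    proof (cases "i \<in> S")
      case True
      show ?thesis
        by (rule exI[of _ "(a, \<lambda>y. - (\<Sum>j<d. b j * y j) - c)"])
          (use True f in \<open>auto simp: holds_def\<close>)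
    next
      case False
      have "holds d (\<lambda>j. - a j, \<lambda>y. (\<Sum>j<d. b j * y j) + c - e) x y \<longleftrightarrow> (f i x y \<le> 0 \<longleftrightarrow> i \<in> S)"
        if "x \<in> V" "y \<in> V" for x y
        using gap[OF that] f[OF that] False by (auto simp: holds_def sum_negf)
      then show ?thesis by blast
    qed
  qed
  then obtain h :: "nat \<Rightarrow> (nat \<Rightarrow> real) halfspace" where
    h: "\<And>i x y. i < s \<Longrightarrow> x \<in> V \<Longrightarrow> y \<in> V \<Longrightarrow>
          holds d (h i) x y \<longleftrightarrow> (f i x y \<le> 0 \<longleftrightarrow> i \<in> S)"
    by metis
  show ?thesis
    by (rule that[of "map h [0..<s]"]) (use h in auto)
qed

text \<open>The factor 2 makes room for disjoint sides: \<open>Q\<close> may contain diagonal pairs.\<close>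

lemma Ktt_free_imp_biclique_free:
  assumes free: "\<not> contains_Ktt t V E" and "Q \<subseteq> V \<times> V"
    and edge: "\<And>x y. (x, y) \<in> Q \<Longrightarrow> x \<noteq> y \<Longrightarrow> {x, y} \<in> E"
  shows "biclique_free (2 * t) Q"
  unfolding biclique_free_def
proof (intro allI impI)
  fix A B
  assume fin: "finite A" "finite B" and AB: "A \<times> B \<subseteq> Q"
  show "card A < 2 * t \<or> card B < 2 * t"
  proof (rule ccontr)
    assume neg: "\<not> ?thesis"
    obtain A' where A': "A' \<subseteq> A" "card A' = t"
      using obtain_subset_with_card_n[of t A] neg by auto
    have "card (B - A') \<ge> t"
      using diff_card_le_card_Diff[of A' B] A' neg fin finite_subset[of A' A] by auto
    then obtain B' where B': "B' \<subseteq> B - A'" "card B' = t"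
      using obtain_subset_with_card_n by metis
    have t: "t \<noteq> 0"
    proof
      assume "t = 0"
      then show False using free unfolding contains_Ktt_def by (metis Int_empty_left card.empty empty_iff empty_subsetI)
    qed
    \<comment> \<open>Both sides must be nonempty for membership in \<open>V\<close> to be read off
      from the product.\<close>
    then have ne: "A' \<noteq> {}" "B' \<noteq> {}" using A' B' by auto
    then have "A' \<subseteq> V" "B' \<subseteq> V" using A' B' AB assms(2) by blast+
    moreover have "\<forall>a\<in>A'. \<forall>b\<in>B'. {a, b} \<in> E"
      using A' B' AB edge by blast
    moreover have "A' \<inter> B' = {}" using B' by auto
    ultimately show False using free A' B' unfolding contains_Ktt_def by blast
  qed
qed

text \<open>Sort the ordered pairs by the truth values of the \<open>s\<close> inequalities. Each of
  the at most \<open>2 ^ s\<close> patterns making the formula true is a conjunction of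
  \<open>s\<close> half-spaces. Both sides are copies of \<open>V\<close>, hence the size
  \<open>2 * card V\<close>.\<close>

lemma semilinear_graph_card_bound:
  assumes "semilinear_graph d s V E" "\<not> contains_Ktt t V E" "2 * card V \<le> 2 ^ m"
  shows "card E \<le> 2 ^ s * ((s + 1) ^ (3 * d) * (2 * t * 2 ^ m * (m + 1) ^ (3 * d)))"
proof -
  obtain f :: "nat \<Rightarrow> (nat \<Rightarrow> real) \<Rightarrow> (nat \<Rightarrow> real) \<Rightarrow> real" and \<Phi>
    where V: "finite V" "V \<subseteq> topspace (Euclidean_space d)" and E: "E \<subseteq> [V]\<^bsup>2\<^esup>"
      and aff: "\<forall>i<s. affine_function d (f i)" and at: "atoms \<Phi> \<subseteq> {..<s}"
      and adj: "\<And>x y. x \<in> V \<Longrightarrow> y \<in> V \<Longrightarrow> x \<noteq> y \<Longrightarrow>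
             {x, y} \<in> E \<longleftrightarrow> satisfies (\<lambda>i. f i x y \<le> 0) \<Phi>"
  proof -
    from assms(1) obtain f \<Phi> where *: "simple_graph V E" "V \<subseteq> topspace (Euclidean_space d)"
        "\<forall>i<s. affine_function d (f i)" "atoms \<Phi> \<subseteq> {..<s}"
        "\<forall>x\<in>V. \<forall>y\<in>V. x \<noteq> y \<longrightarrow> {x, y} \<in> E \<longleftrightarrow> satisfies (\<lambda>i. f i x y \<le> 0) \<Phi>"
      unfolding semilinear_graph_def by (elim conjE exE)
    show ?thesis
      by (rule that[of f \<Phi>]) (use * in \<open>simp_all add: simple_graph_def\<close>)
  qed
  define pat where "pat = (\<lambda>S. {(x, y) \<in> V \<times> V. \<forall>i<s. f i x y \<le> 0 \<longleftrightarrow> i \<in> S})"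
  define \<S> where "\<S> = {S \<in> Pow {..<s}. satisfies (\<lambda>i. i \<in> S) \<Phi>}"
  have sat: "satisfies (\<lambda>i. f i x y \<le> 0) \<Phi> \<longleftrightarrow> satisfies (\<lambda>i. i \<in> S) \<Phi>"
    if "(x, y) \<in> pat S" for x y S
    by (rule satisfies_cong) (use that at in \<open>auto simp: pat_def\<close>)
  have fin: "finite \<S>" "finite (pat S)" for S
    unfolding \<S>_def using V finite_subset[of "pat S" "V \<times> V"] by (auto simp: pat_def)
  have "card (pat S) \<le> (s + 1) ^ (3 * d) * (2 * t * 2 ^ m * (m + 1) ^ (3 * d))"
    if "S \<in> \<S>" for S
  proof -
    obtain hs :: "(nat \<Rightarrow> real) halfspace list" where hs: "length hs = s"
      "\<And>x y. x \<in> V \<Longrightarrow> y \<in> V \<Longrightarrow>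
         (\<forall>h\<in>set hs. holds d h x y) \<longleftrightarrow> (\<forall>i<s. f i x y \<le> 0 \<longleftrightarrow> i \<in> S)"
      using affine_pattern_halfspaces[OF aff V] by blast
    have eq: "pat S = {(x, y) \<in> V \<times> V. (\<forall>P\<in>set []. P x y) \<and> (\<forall>h\<in>set hs. holds d h x y)}"
      unfolding pat_def using hs(2) by auto
    have "{x, y} \<in> E" if "(x, y) \<in> pat S" "x \<noteq> y" for x y
      using that adj sat[OF that(1)] \<open>S \<in> \<S>\<close> by (auto simp: \<S>_def pat_def)
    then have "biclique_free (2 * t) (pat S)"
      by (intro Ktt_free_imp_biclique_free[OF assms(2)]) (auto simp: pat_def)
    then show ?thesis
      using halfspaces_card_bound[of V V m "[]" "2 * t" hs d] V assms(3) hs(1) unfolding eq by simp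
  qed
  then have "(\<Sum>S\<in>\<S>. card (pat S))
      \<le> card \<S> * ((s + 1) ^ (3 * d) * (2 * t * 2 ^ m * (m + 1) ^ (3 * d)))"
    using sum_bounded_above[of \<S> "\<lambda>S. card (pat S)"] by simp
  moreover have "card \<S> \<le> 2 ^ s"
  proof -
    have "card \<S> \<le> card (Pow {..<s})" by (rule card_mono) (auto simp: \<S>_def)
    then show ?thesis by (simp add: card_Pow)
  qed
  moreover have "card E \<le> (\<Sum>S\<in>\<S>. card (pat S))"
  proof -
    \<comment> \<open>Either ordering of an edge lies in the pattern it realizes; diagonal pairs
      only enlarge the image.\<close>
    have "E \<subseteq> (\<lambda>(x, y). {x, y}) ` (\<Union>S\<in>\<S>. pat S)"
    proof
      fix e assume "e \<in> E"
      then obtain x y where xy: "e = {x, y}" "x \<noteq> y" "x \<in> V" "y \<in> V"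
        using E unfolding nsets_def by (auto simp: card_2_iff)
      define S where "S = {i. i < s \<and> f i x y \<le> 0}"
      have "(x, y) \<in> pat S" using xy by (simp add: pat_def S_def)
      moreover from this have "S \<in> \<S>"
        using sat adj xy \<open>e \<in> E\<close> by (auto simp: \<S>_def S_def)
      ultimately show "e \<in> (\<lambda>(x, y). {x, y}) ` (\<Union>S\<in>\<S>. pat S)" using xy by force
    qed
    then have "card E \<le> card (\<Union>S\<in>\<S>. pat S)"
      using fin by (meson finite_UN_I surj_card_le)
    also have "\<dots> \<le> (\<Sum>S\<in>\<S>. card (pat S))" by (rule card_UN_le[OF fin(1)])
    finally show ?thesis .
  qed
  ultimately show ?thesis by (meson le_trans mult_le_mono1)
qed

section \<open>Logarithms and the final estimate\<close>

lemma dyadic_scale: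
  assumes "n \<ge> (3::nat)"
  obtains m where "2 * n \<le> 2 ^ m" "2 ^ m \<le> 4 * n" "real (m + 1) \<le> 5 * ln (real n)"
proof -
  obtain k where k: "2 ^ k \<le> n" "n < 2 ^ (k + 1)"
    using ex_power_ivl1[of 2 n] assms by auto
  \<comment> \<open>Here \<open>n \<ge> 3\<close> enters, through e <= 3; it lets additive constants
    be absorbed into the logarithm.\<close>
  have ln1: "ln (real n) \<ge> 1"
    using assms exp_le by (subst ln_ge_iff) auto
  \<comment> \<open>From e <= 4 follows ln 2 >= 1/2, which turns k into at most 2 ln n.\<close>
  have "1 \<le> ln ((2::real) ^ 2)"
    using exp_le by (subst ln_ge_iff) auto
  then have ln2: "1 / 2 \<le> ln (2::real)" by (subst (asm) ln_realpow) simp_all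
  have "ln (2 ^ k) \<le> ln (real n)"
    using k(1) assms by (subst ln_le_cancel_iff) (use of_nat_mono[OF k(1), where 'a = real] in auto)
  then have "real k * ln 2 \<le> ln (real n)" by (simp add: ln_realpow)
  moreover have "real k * (1 / 2) \<le> real k * ln 2"
    using ln2 by (intro mult_left_mono) auto
  ultimately have "real k \<le> 2 * ln (real n)" by linarith
  \<comment> \<open>With m = k + 2, m + 1 = k + 3 <= 2 ln n + 3 <= 5 ln n.\<close>
  then show ?thesis
    using k ln1 by (intro that[of "k + 2"]) auto
qed

theorem theorem1p8:
  "\<exists>c::real. c > 0 \<and>
     (\<forall>d s :: nat. d \<ge> 1 \<longrightarrow> s \<ge> 1 \<longrightarrow>
       (\<exists>C::real. C > 0 \<and>
         (\<forall>(t::nat) (n::nat) (V :: (nat \<Rightarrow> real) set) (E :: (nat \<Rightarrow> real) set set).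
            t \<ge> 1 \<longrightarrow> n \<ge> 3 \<longrightarrow> semilinear_graph d s V E \<longrightarrow> card V = n \<longrightarrow>
            \<not> contains_Ktt t V E \<longrightarrow>
            real (card E) \<le> C * real t * real n * (ln (real n)) powr (c * real d))))"
proof (rule exI[of _ 3], rule conjI, goal_cases)
  case 2
  show ?case
  proof (rule allI, rule allI, rule impI, rule impI)
    fix d s :: nat
    \<comment> \<open>The factors count the patterns and the pieces; 8 is the 2 of
      \<open>2 * t\<close> times the 4 of \<open>2 ^ m \<le> 4 * n\<close>, and the power of 5 comes
      from \<open>m + 1\<close>. The exponent \<open>3 * d\<close> reflects three Ferrers relations
      per eliminated coordinate.\<close>
    define C :: real where "C = 2 ^ s * (real s + 1) ^ (3 * d) * 8 * 5 ^ (3 * d)"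
    show "\<exists>C::real. C > 0 \<and>
           (\<forall>(t::nat) (n::nat) (V :: (nat \<Rightarrow> real) set) (E :: (nat \<Rightarrow> real) set set).
              t \<ge> 1 \<longrightarrow> n \<ge> 3 \<longrightarrow> semilinear_graph d s V E \<longrightarrow> card V = n \<longrightarrow>
              \<not> contains_Ktt t V E \<longrightarrow>
              real (card E) \<le> C * real t * real n * (ln (real n)) powr (3 * real d))"
    proof (intro exI[of _ C] conjI allI impI)
      show "C > 0" unfolding C_def by (simp add: add_nonneg_pos)
    next
      fix t n :: nat and V :: "(nat \<Rightarrow> real) set" and E
      assume n: "n \<ge> 3" "card V = n" and G: "semilinear_graph d s V E" "\<not> contains_Ktt t V E"
      obtain m where m: "2 * n \<le> 2 ^ m" "2 ^ m \<le> 4 * n" "real (m + 1) \<le> 5 * ln (real n)"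
        using dyadic_scale[OF n(1)] .
      have "ln (real n) > 0" using n by simp
      then have powr: "ln (real n) powr (3 * real d) = ln (real n) ^ (3 * d)"
        by (metis of_nat_mult of_nat_numeral powr_realpow)
      have "2 ^ m \<le> 4 * real n" using of_nat_mono[OF m(2), where 'a = real] by simp
      have "real (card E)
          \<le> real (2 ^ s * ((s + 1) ^ (3 * d) * (2 * t * 2 ^ m * (m + 1) ^ (3 * d))))"
        using semilinear_graph_card_bound[OF G, of m] m(1) n(2) of_nat_mono by blast
      also have "\<dots> = 2 ^ s * ((real s + 1) ^ (3 * d) *
          (2 * real t * 2 ^ m * real (m + 1) ^ (3 * d)))"
        by (simp add: add.commute)
      also have "\<dots> \<le> 2 ^ s * ((real s + 1) ^ (3 * d) *
          (2 * real t * (4 * real n) * (5 * ln (real n)) ^ (3 * d)))"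
        using m(3) \<open>2 ^ m \<le> 4 * real n\<close> by (intro mult_left_mono mult_mono power_mono) auto
      also have "\<dots> = C * real t * real n * ln (real n) powr (3 * real d)"
        unfolding powr C_def power_mult_distrib by simp
      finally show "real (card E) \<le> C * real t * real n * ln (real n) powr (3 * real d)" .
    qed
  qed
qed simp

end
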